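(* Let $f_1,\ldots,f_m\in\mathbb{F}[x_1,\ldots,x_n]$ be multilinear polynomials, each of degree at most $d$ and $s$-sparse, that have no common zero in $\{0,1\}^n$. Suppose they have a sparse linear-IPS refutation, that is, there are $t$-sparse polynomials $g_1,\ldots,g_m,h_1,\ldots,h_n\in\mathbb{F}[\overline{x}]$ such that $\sum_{j=1}^m g_j f_j+\sum_{i=1}^n h_i\cdot(x_i^2-x_i)=1$. Then the system $f_1,\ldots,f_m$, $\{x_i^2-x_i\}_{i=1}^n$ can be refuted by a depth-2 multilinear-formula-$\mathrm{IPS}_{\mathrm{LIN}'}$ proof of size $\mathrm{poly}(s,t,n,m,2^d)$, and also by a depth-3 multilinear-formula-$\mathrm{IPS}_{\mathrm{LIN}'}$ proof of size $\mathrm{poly}(s,t,n,m,d)$.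
   Context: $\mathbb{F}$ is a field. A polynomial is $s$-sparse if it is a linear combination of at most $s$ monomials. A multilinear formula is an algebraic formula (unbounded fan-in addition and multiplication gates) in which every gate computes a multilinear polynomial (as a formal polynomial); depth-2 means a sum of products of variables and constants ($\sum\prod$), depth-3 means $\sum\prod\sum$. An $\mathrm{IPS}_{\mathrm{LIN}'}$ refutation of $f_1,\ldots,f_m$, $\{x_i^2-x_i\}_{i=1}^n$ is a polynomial $C(\overline{x},\overline{y},\overline{z})\in\mathbb{F}[x_1,\ldots,x_n,y_1,\ldots,y_m,z_1,\ldots,z_n]$ with $C(\overline{x},\overline{0},\overline{0})=0$, $C(\overline{x},f_1,\ldots,f_m,x_1^2-x_1,\ldots,x_n^2-x_n)=1$ (as polynomial identities), and $C$ of degree at most $1$ in the variables $\overline{y}$ (no such restriction on $\overline{z}$). A (depth-$D$) multilinear-formula-$\mathrm{IPS}_{\mathrm{LIN}'}$ proof is such a $C$ computed by a (depth-$D$) multilinear formula in the variables $\overline{x},\overline{y},\overline{z}$; its size is the size of that formula. *)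

theory Defs
  imports Complex_Main "HOL-Library.Poly_Mapping"
begin

section \<open>Multivariate polynomials\<close>

text \<open>A polynomial over \<open>'a\<close> in variables of type \<open>'v\<close> is a finitely supported map from monomials
  (finitely supported exponent vectors) to coefficients; ring operations and equality are those of
  \<^theory>\<open>HOL-Library.Poly_Mapping\<close>, so equality is identity of formal polynomials.\<close>

type_synonym ('v, 'a) mpoly = "('v \<Rightarrow>\<^sub>0 nat) \<Rightarrow>\<^sub>0 'a"

definition mconst :: "'a::zero \<Rightarrow> ('v, 'a) mpoly" where
  "mconst c = Poly_Mapping.single 0 c"

definition mvar :: "'v \<Rightarrow> ('v, 'a::zero_neq_one) mpoly" where
  "mvar v = Poly_Mapping.single (Poly_Mapping.single v 1) 1"

definition mvars :: "('v, 'a::zero) mpoly \<Rightarrow> 'v set" where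
  "mvars p = (\<Union>u\<in>Poly_Mapping.keys p. Poly_Mapping.keys u)"

definition monom_degree :: "('v \<Rightarrow>\<^sub>0 nat) \<Rightarrow> nat" where
  "monom_degree u = (\<Sum>v\<in>Poly_Mapping.keys u. Poly_Mapping.lookup u v)"

text \<open>The zero polynomial gets degree 0.\<close>

definition total_degree :: "('v, 'a::zero) mpoly \<Rightarrow> nat" where
  "total_degree p = Max (insert 0 (monom_degree ` Poly_Mapping.keys p))"

definition sparse :: "nat \<Rightarrow> ('v, 'a::zero) mpoly \<Rightarrow> bool" where
  "sparse s p \<longleftrightarrow> card (Poly_Mapping.keys p) \<le> s"

definition multilinear :: "('v, 'a::zero) mpoly \<Rightarrow> bool" where
  "multilinear p \<longleftrightarrow> (\<forall>u\<in>Poly_Mapping.keys p. \<forall>v. Poly_Mapping.lookup u v \<le> 1)"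

definition mpoly_eval :: "('v \<Rightarrow> 'a) \<Rightarrow> ('v, 'a::comm_semiring_1) mpoly \<Rightarrow> 'a" where
  "mpoly_eval a p = (\<Sum>u\<in>Poly_Mapping.keys p. Poly_Mapping.lookup p u *
     (\<Prod>v\<in>Poly_Mapping.keys u. a v ^ Poly_Mapping.lookup u v))"

definition mpoly_subst ::
    "('v \<Rightarrow> ('w, 'a) mpoly) \<Rightarrow> ('v, 'a::comm_semiring_1) mpoly \<Rightarrow> ('w, 'a) mpoly" where
  "mpoly_subst \<sigma> p = (\<Sum>u\<in>Poly_Mapping.keys p. mconst (Poly_Mapping.lookup p u) *
     (\<Prod>v\<in>Poly_Mapping.keys u. \<sigma> v ^ Poly_Mapping.lookup u v))"

section \<open>Algebraic formulas\<close>

text \<open>Gates have arbitrary (also empty or unary) fan-in; field constants occur only at leaves.\<close>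

datatype ('v, 'a) formula =
    Var 'v
  | Const 'a
  | Add "('v, 'a) formula list"
  | Mul "('v, 'a) formula list"

primrec formula_poly :: "('v, 'a::comm_semiring_1) formula \<Rightarrow> ('v, 'a) mpoly" where
  "formula_poly (Var v) = mvar v"
| "formula_poly (Const c) = mconst c"
| "formula_poly (Add \<phi>s) = sum_list (map formula_poly \<phi>s)"
| "formula_poly (Mul \<phi>s) = prod_list (map formula_poly \<phi>s)"

text \<open>Size is the number of nodes of the formula tree, leaves included.\<close>

primrec formula_size :: "('v, 'a) formula \<Rightarrow> nat" where
  "formula_size (Var v) = 1"
| "formula_size (Const c) = 1"
| "formula_size (Add \<phi>s) = 1 + sum_list (map formula_size \<phi>s)"
| "formula_size (Mul \<phi>s) = 1 + sum_list (map formula_size \<phi>s)"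

primrec gates :: "('v, 'a) formula \<Rightarrow> ('v, 'a) formula set" where
  "gates (Var v) = {Var v}"
| "gates (Const c) = {Const c}"
| "gates (Add \<phi>s) = insert (Add \<phi>s) (\<Union>(set (map gates \<phi>s)))"
| "gates (Mul \<phi>s) = insert (Mul \<phi>s) (\<Union>(set (map gates \<phi>s)))"

definition formula_vars :: "('v, 'a) formula \<Rightarrow> 'v set" where
  "formula_vars \<phi> = {v. Var v \<in> gates \<phi>}"

definition multilinear_formula :: "('v, 'a::comm_semiring_1) formula \<Rightarrow> bool" where
  "multilinear_formula \<phi> \<longleftrightarrow> (\<forall>\<psi>\<in>gates \<phi>. multilinear (formula_poly \<psi>))"

definition is_leaf :: "('v, 'a) formula \<Rightarrow> bool" where
  "is_leaf \<phi> \<longleftrightarrow> (\<exists>v. \<phi> = Var v) \<or> (\<exists>c. \<phi> = Const c)"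

definition sum_of :: "(('v, 'a) formula \<Rightarrow> bool) \<Rightarrow> ('v, 'a) formula \<Rightarrow> bool" where
  "sum_of P \<phi> \<longleftrightarrow> (\<exists>\<psi>s. \<phi> = Add \<psi>s \<and> (\<forall>\<psi>\<in>set \<psi>s. P \<psi>))"

definition prod_of :: "(('v, 'a) formula \<Rightarrow> bool) \<Rightarrow> ('v, 'a) formula \<Rightarrow> bool" where
  "prod_of P \<phi> \<longleftrightarrow> (\<exists>\<psi>s. \<phi> = Mul \<psi>s \<and> (\<forall>\<psi>\<in>set \<psi>s. P \<psi>))"

definition depth2 :: "('v, 'a) formula \<Rightarrow> bool" where
  "depth2 = sum_of (prod_of is_leaf)"

definition depth3 :: "('v, 'a) formula \<Rightarrow> bool" where
  "depth3 = sum_of (prod_of (sum_of is_leaf))"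

section \<open>The proof system\<close>

text \<open>The ring \<open>F[x\<^sub>1, \<dots>, x\<^sub>n]\<close>, with \<open>x\<^sub>i\<close> represented by the number \<open>i\<close>.\<close>

definition xpolys :: "nat \<Rightarrow> (nat, 'a::zero) mpoly set" where
  "xpolys n = {p. mvars p \<subseteq> {1..n}}"

definition bool_axiom :: "nat \<Rightarrow> (nat, 'a::comm_ring_1) mpoly" where
  "bool_axiom i = mvar i ^ 2 - mvar i"

datatype ips_var = X nat | Y nat | Z nat

definition ips_vars :: "nat \<Rightarrow> nat \<Rightarrow> ips_var set" where
  "ips_vars n m = X ` {1..n} \<union> Y ` {1..m} \<union> Z ` {1..n}"

definition y_degree :: "(ips_var \<Rightarrow>\<^sub>0 nat) \<Rightarrow> nat" where
  "y_degree u = (\<Sum>v\<in>Poly_Mapping.keys u \<inter> range Y. Poly_Mapping.lookup u v)"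

primrec zero_subst :: "ips_var \<Rightarrow> (nat, 'a::comm_ring_1) mpoly" where
  "zero_subst (X i) = mvar i"
| "zero_subst (Y j) = 0"
| "zero_subst (Z i) = 0"

primrec axiom_subst ::
    "(nat \<Rightarrow> (nat, 'a::comm_ring_1) mpoly) \<Rightarrow> ips_var \<Rightarrow> (nat, 'a) mpoly" where
  "axiom_subst f (X i) = mvar i"
| "axiom_subst f (Y j) = f j"
| "axiom_subst f (Z i) = bool_axiom i"

definition ips_lin'_refutation ::
    "nat \<Rightarrow> nat \<Rightarrow> (nat \<Rightarrow> (nat, 'a::comm_ring_1) mpoly) \<Rightarrow> (ips_var, 'a) mpoly \<Rightarrow> bool" where
  "ips_lin'_refutation n m f C \<longleftrightarrow>
     mvars C \<subseteq> ips_vars n m \<and>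
     mpoly_subst zero_subst C = 0 \<and>
     mpoly_subst (axiom_subst f) C = 1 \<and>
     (\<forall>u\<in>Poly_Mapping.keys C. y_degree u \<le> 1)"

definition multilinear_formula_ips_lin'_proof ::
    "nat \<Rightarrow> nat \<Rightarrow> (nat \<Rightarrow> (nat, 'a::comm_ring_1) mpoly) \<Rightarrow> (ips_var, 'a) formula \<Rightarrow> bool" where
  "multilinear_formula_ips_lin'_proof n m f \<Phi> \<longleftrightarrow>
     multilinear_formula \<Phi> \<and>
     formula_vars \<Phi> \<subseteq> ips_vars n m \<and>
     ips_lin'_refutation n m f (formula_poly \<Phi>)"

text \<open>A linear-IPS refutation all of whose coefficient polynomials are \<open>t\<close>-sparse.\<close>

definition sparse_lin_ips_refutation ::
    "nat \<Rightarrow> nat \<Rightarrow> nat \<Rightarrow> (nat \<Rightarrow> (nat, 'a::comm_ring_1) mpoly) \<Rightarrow>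
     (nat \<Rightarrow> (nat, 'a) mpoly) \<Rightarrow> (nat \<Rightarrow> (nat, 'a) mpoly) \<Rightarrow> bool" where
  "sparse_lin_ips_refutation t n m f g h \<longleftrightarrow>
     (\<forall>j\<in>{1..m}. g j \<in> xpolys n \<and> sparse t (g j)) \<and>
     (\<forall>i\<in>{1..n}. h i \<in> xpolys n \<and> sparse t (h i)) \<and>
     (\<Sum>j=1..m. g j * f j) + (\<Sum>i=1..n. h i * bool_axiom i) = 1"

end

theory Submission
  imports Defs
begin

text \<open>Expand the given refutation into monomials. For monomials with supports \<open>A\<close> and \<open>B\<close>, let
  \<open>P(x, z)\<close> be the product over \<open>i \<in> A \<union> B\<close> of \<open>x\<^sub>i + z\<^sub>i\<close> if \<open>i \<in> A \<inter> B\<close> and of \<open>x\<^sub>i\<close> otherwise.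
  Substituting \<open>z\<^sub>i = x\<^sub>i\<^sup>2 - x\<^sub>i\<close> turns \<open>P\<close> into \<open>x\<^sup>A x\<^sup>B\<close>, while \<open>P(x, 0)\<close> is the multilinear monomial
  \<open>x\<^bsup>A \<union> B\<^esup>\<close>. So adding the corrections \<open>P(x, 0) - P(x, z)\<close> to \<open>\<Sum> g\<^sub>j y\<^sub>j\<close>, with \<open>g\<^sub>j\<close> made multilinear,
  yields a polynomial that vanishes at \<open>y = z = 0\<close> and evaluates at the axioms to the
  multilinearization of \<open>\<Sum> g\<^sub>j f\<^sub>j\<close>, which is that of 1. In depth 3 the product \<open>P\<close> is written down
  directly; in depth 2 it is expanded into \<open>2\<^bsup>|A \<inter> B|\<^esup> \<le> 2\<^sup>d\<close> monomials, as \<open>|B| \<le> d\<close>.\<close>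

section \<open>Substitution and multilinearization\<close>

lemma mconst_0 [simp]: "mconst 0 = 0"
  by (simp add: mconst_def)

lemma mconst_1 [simp]: "mconst 1 = 1"
  by (simp add: mconst_def)

lemma mconst_add: "mconst (a + b) = mconst a + mconst b"
  by (simp add: mconst_def single_add)

lemma mconst_mult: "mconst (a * b) = mconst a * mconst b"
  by (simp add: mconst_def mult_single)

lemma mconst_uminus: "mconst (- a) = - mconst a"
  by (simp add: mconst_def single_uminus)

lemma single_eq_mconst_mult:
  "Poly_Mapping.single u c = mconst c * (Poly_Mapping.single u 1 :: ('v, 'a::comm_semiring_1) mpoly)"
  by (simp add: mconst_def mult_single)

lemma keys_add_nat:
  fixes u w :: "'v \<Rightarrow>\<^sub>0 nat"
  shows "Poly_Mapping.keys (u + w) = Poly_Mapping.keys u \<union> Poly_Mapping.keys w"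
  by (auto simp: in_keys_iff lookup_add)

lemma keys_multE:
  assumes "u \<in> Poly_Mapping.keys (p * q)"
  obtains v w where "v \<in> Poly_Mapping.keys p" "w \<in> Poly_Mapping.keys q" "u = v + w"
  using assms keys_mult[of p q] by blast

text \<open>The linear extension of an arbitrary map \<open>M\<close> on monomials. Substitution
  (where \<open>M\<close> is multiplicative) and multilinearization (where \<open>M\<close> sees
  only the support) are both instances, so linearity is proved once for the two.\<close>

definition replace_monomials ::
    "(('v \<Rightarrow>\<^sub>0 nat) \<Rightarrow> ('w, 'a) mpoly) \<Rightarrow> ('v, 'a::comm_semiring_1) mpoly \<Rightarrow> ('w, 'a) mpoly" where
  "replace_monomials M p =
     (\<Sum>u\<in>Poly_Mapping.keys p. mconst (Poly_Mapping.lookup p u) * M u)"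

lemma replace_monomials_0 [simp]: "replace_monomials M 0 = 0"
  by (simp add: replace_monomials_def)

lemma replace_monomials_single [simp]:
  "replace_monomials M (Poly_Mapping.single u c) = mconst c * M u"
  by (simp add: replace_monomials_def)

lemma replace_monomials_add:
  "replace_monomials M (p + q) = replace_monomials M p + replace_monomials M q"
  unfolding replace_monomials_def
  by (rule setsum_keys_plus_distrib) (simp_all add: mconst_add distrib_right)

lemma replace_monomials_sum:
  "replace_monomials M (\<Sum>i\<in>I. p i) = (\<Sum>i\<in>I. replace_monomials M (p i))"
  by (induction I rule: infinite_finite_induct) (simp_all add: replace_monomials_add)

lemma replace_monomials_uminus:
  fixes p :: "('v, 'a::comm_ring_1) mpoly"
  shows "replace_monomials M (- p) = - replace_monomials M p"
  using replace_monomials_add[of M p "- p"] by (simp add: eq_neg_iff_add_eq_0 add.commute)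

lemma replace_monomials_diff:
  fixes p :: "('v, 'a::comm_ring_1) mpoly"
  shows "replace_monomials M (p - q) = replace_monomials M p - replace_monomials M q"
  using replace_monomials_add[of M p "- q"] by (simp add: replace_monomials_uminus)

lemma sum_monomials:
  "(\<Sum>u\<in>Poly_Mapping.keys p. Poly_Mapping.single u (Poly_Mapping.lookup p u)) = p"
  by (rule poly_mapping_eqI) (simp add: lookup_sum lookup_single when_def in_keys_iff)

text \<open>Both factors are expanded into monomials and no like terms are collected, so nothing is
  required of \<open>M\<close>. The resulting double sum is the shape in which
  \<open>certificate\<close> is written.\<close>

lemma replace_monomials_mult:
  "replace_monomials M (p * q) =
     (\<Sum>u\<in>Poly_Mapping.keys p. \<Sum>w\<in>Poly_Mapping.keys q.
        mconst (Poly_Mapping.lookup p u * Poly_Mapping.lookup q w) * M (u + w))"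
proof -
  have "p * q =
      (\<Sum>u\<in>Poly_Mapping.keys p. Poly_Mapping.single u (Poly_Mapping.lookup p u)) *
      (\<Sum>w\<in>Poly_Mapping.keys q. Poly_Mapping.single w (Poly_Mapping.lookup q w))"
    by (simp only: sum_monomials)
  then show ?thesis
    by (simp add: sum_product replace_monomials_sum mult_single)
qed

section \<open>Substitution as a ring homomorphism\<close>

lemma mpoly_subst_eq_replace_monomials:
  "mpoly_subst \<sigma> = replace_monomials (\<lambda>u. \<Prod>v\<in>Poly_Mapping.keys u. \<sigma> v ^ Poly_Mapping.lookup u v)"
  by (simp add: fun_eq_iff mpoly_subst_def replace_monomials_def)

text \<open>Variables outside the support have exponent 0 and contribute the factor 1. This puts two
  monomials over a common index set before their exponents are added.\<close>

lemma prod_power_lookup_superset: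
  assumes "finite A" "Poly_Mapping.keys u \<subseteq> A"
  shows "(\<Prod>v\<in>Poly_Mapping.keys u. \<sigma> v ^ Poly_Mapping.lookup u v)
       = (\<Prod>v\<in>A. (\<sigma> v :: 'b::comm_semiring_1) ^ Poly_Mapping.lookup u v)"
  using assms by (intro prod.mono_neutral_left) (auto simp: in_keys_iff)

lemma prod_power_lookup_add:
  fixes \<sigma> :: "'v \<Rightarrow> 'b::comm_semiring_1"
  shows "(\<Prod>v\<in>Poly_Mapping.keys (u + w). \<sigma> v ^ Poly_Mapping.lookup (u + w) v)
       = (\<Prod>v\<in>Poly_Mapping.keys u. \<sigma> v ^ Poly_Mapping.lookup u v) *
         (\<Prod>v\<in>Poly_Mapping.keys w. \<sigma> v ^ Poly_Mapping.lookup w v)"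
proof -
  let ?A = "Poly_Mapping.keys u \<union> Poly_Mapping.keys w"
  have "(\<Prod>v\<in>Poly_Mapping.keys u. \<sigma> v ^ Poly_Mapping.lookup u v)
      = (\<Prod>v\<in>?A. \<sigma> v ^ Poly_Mapping.lookup u v)"
    and "(\<Prod>v\<in>Poly_Mapping.keys w. \<sigma> v ^ Poly_Mapping.lookup w v)
      = (\<Prod>v\<in>?A. \<sigma> v ^ Poly_Mapping.lookup w v)"
    by (rule prod_power_lookup_superset; simp)+
  then show ?thesis
    by (simp add: keys_add_nat lookup_add power_add prod.distrib)
qed

lemma mpoly_subst_mconst [simp]: "mpoly_subst \<sigma> (mconst c) = mconst c"
  by (simp add: mpoly_subst_eq_replace_monomials mconst_def)

lemma mpoly_subst_1 [simp]: "mpoly_subst \<sigma> 1 = 1"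
  using mpoly_subst_mconst[of \<sigma> 1] by simp

lemma mpoly_subst_mvar [simp]: "mpoly_subst \<sigma> (mvar v) = \<sigma> v"
  by (simp add: mpoly_subst_eq_replace_monomials mvar_def)

lemma mpoly_subst_add: "mpoly_subst \<sigma> (p + q) = mpoly_subst \<sigma> p + mpoly_subst \<sigma> q"
  by (simp add: mpoly_subst_eq_replace_monomials replace_monomials_add)

lemma mpoly_subst_diff:
  fixes p :: "('v, 'a::comm_ring_1) mpoly"
  shows "mpoly_subst \<sigma> (p - q) = mpoly_subst \<sigma> p - mpoly_subst \<sigma> q"
  by (simp add: mpoly_subst_eq_replace_monomials replace_monomials_diff)

lemma mpoly_subst_mult: "mpoly_subst \<sigma> (p * q) = mpoly_subst \<sigma> p * mpoly_subst \<sigma> q"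
proof -
  let ?M = "\<lambda>u. \<Prod>v\<in>Poly_Mapping.keys u. \<sigma> v ^ Poly_Mapping.lookup u v"
  have "mpoly_subst \<sigma> (p * q) =
      (\<Sum>u\<in>Poly_Mapping.keys p. \<Sum>w\<in>Poly_Mapping.keys q.
        (mconst (Poly_Mapping.lookup p u) * ?M u) * (mconst (Poly_Mapping.lookup q w) * ?M w))"
    unfolding mpoly_subst_eq_replace_monomials replace_monomials_mult
    by (intro sum.cong refl) (simp add: prod_power_lookup_add mconst_mult algebra_simps)
  also have "\<dots> = mpoly_subst \<sigma> p * mpoly_subst \<sigma> q"
    by (simp add: mpoly_subst_def sum_product)
  finally show ?thesis .
qed

lemma mpoly_subst_sum: "mpoly_subst \<sigma> (\<Sum>i\<in>I. p i) = (\<Sum>i\<in>I. mpoly_subst \<sigma> (p i))"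
  by (simp add: mpoly_subst_eq_replace_monomials replace_monomials_sum)

lemma mpoly_subst_prod: "mpoly_subst \<sigma> (\<Prod>i\<in>I. p i) = (\<Prod>i\<in>I. mpoly_subst \<sigma> (p i))"
  by (induction I rule: infinite_finite_induct) (simp_all add: mpoly_subst_mult)

text \<open>Every positive exponent is lowered to 1: the multilinear normal form modulo the
  polynomials x_i^2 - x_i.\<close>

definition multilinearize :: "('v, 'a::comm_semiring_1) mpoly \<Rightarrow> ('v, 'a) mpoly" where
  "multilinearize = replace_monomials (\<lambda>u. \<Prod>v\<in>Poly_Mapping.keys u. mvar v)"

lemma multilinearize_1: "multilinearize (1 :: ('v, 'a::comm_semiring_1) mpoly) = 1"
  using replace_monomials_single[of "\<lambda>u. \<Prod>v\<in>Poly_Mapping.keys u. mvar v" 0 1]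
  by (simp add: multilinearize_def)

lemma mpoly_eq_sum_mvar:
  fixes p :: "('v, 'a::comm_semiring_1) mpoly"
  shows "p = (\<Sum>u\<in>Poly_Mapping.keys p. mconst (Poly_Mapping.lookup p u) *
         (\<Prod>v\<in>Poly_Mapping.keys u. mvar v ^ Poly_Mapping.lookup u v))"
proof -
  have mvar_power: "mvar v ^ k = (Poly_Mapping.single (Poly_Mapping.single v k) 1 :: ('v, 'a) mpoly)" for v :: 'v and k
    by (induction k) (simp_all add: mvar_def mult_single flip: single_add)
  have prod_single: "(\<Prod>v\<in>A. Poly_Mapping.single (f v) 1) = (Poly_Mapping.single (\<Sum>v\<in>A. f v) 1 :: ('v, 'a) mpoly)"
    if "finite A" for A :: "'v set" and f
    using that by induction (simp_all add: mult_single)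
  have "mconst c * (\<Prod>v\<in>Poly_Mapping.keys u. mvar v ^ Poly_Mapping.lookup u v) = Poly_Mapping.single u c"
    for u :: "'v \<Rightarrow>\<^sub>0 nat" and c :: 'a
    by (simp add: mvar_power prod_single sum_monomials flip: single_eq_mconst_mult)
  then show ?thesis
    by (simp add: sum_monomials)
qed

text \<open>In a multilinear polynomial the exponents on the support of a monomial are nonzero and
  at most 1, so lowering them to 1 changes nothing.\<close>

lemma multilinearize_multilinear:
  assumes "multilinear p"
  shows "multilinearize p = p"
proof -
  have "Poly_Mapping.lookup u v = 1" if "u \<in> Poly_Mapping.keys p" "v \<in> Poly_Mapping.keys u" for u v
  proof -
    have "Poly_Mapping.lookup u v \<le> 1" using assms that by (auto simp: multilinear_def)
    moreover have "Poly_Mapping.lookup u v \<noteq> 0" using that by (simp add: in_keys_iff)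
    ultimately show ?thesis by simp
  qed
  then have "multilinearize p = (\<Sum>u\<in>Poly_Mapping.keys p. mconst (Poly_Mapping.lookup p u) *
         (\<Prod>v\<in>Poly_Mapping.keys u. mvar v ^ Poly_Mapping.lookup u v))"
    unfolding multilinearize_def replace_monomials_def by (intro sum.cong refl) simp
  then show ?thesis
    by (simp flip: mpoly_eq_sum_mvar)
qed

text \<open>Multiplying a monomial of \<open>h\<close> by x_i^2 or by x_i has the same effect on its
  support, namely adding \<open>i\<close>. The two contributions therefore cancel monomial by
  monomial.\<close>

lemma multilinearize_mult_bool_axiom:
  fixes h :: "(nat, 'a::comm_ring_1) mpoly"
  shows "multilinearize (h * bool_axiom i) = 0"
proof -
  have "mvar i ^ 2 = (Poly_Mapping.single (Poly_Mapping.single i 2) 1 :: (nat, 'a) mpoly)"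
    by (simp add: mvar_def power2_eq_square mult_single flip: single_add numeral_2_eq_2)
  then have "multilinearize (h * bool_axiom i)
      = multilinearize (h * Poly_Mapping.single (Poly_Mapping.single i 2) 1)
      - multilinearize (h * Poly_Mapping.single (Poly_Mapping.single i 1) 1)"
    by (simp add: bool_axiom_def right_diff_distrib multilinearize_def replace_monomials_diff mvar_def)
  also have "\<dots> = 0"
    by (simp add: multilinearize_def replace_monomials_mult keys_add_nat)
  finally show ?thesis .
qed


section \<open>Variables and multilinearity\<close>

lemma mvars_0 [simp]: "mvars 0 = {}"
  by (simp add: mvars_def)

lemma mvars_mconst [simp]: "mvars (mconst c) = {}"
  by (auto simp: mvars_def mconst_def split: if_splits)

lemma mvars_1 [simp]: "mvars (1 :: ('v, 'a::comm_semiring_1) mpoly) = {}"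
  by (simp flip: mconst_1)

lemma mvars_mvar [simp]: "mvars (mvar v) = {v}"
  by (simp add: mvars_def mvar_def)

lemma mvars_add: "mvars (p + q) \<subseteq> mvars p \<union> mvars q"
  using keys_add[of p q] by (auto simp: mvars_def)

lemma mvars_mult: "mvars (p * q) \<subseteq> mvars p \<union> mvars q"
  by (fastforce simp: mvars_def keys_add_nat elim!: keys_multE)

lemma mvars_sum_list: "mvars (sum_list ps) \<subseteq> (\<Union>p\<in>set ps. mvars p)"
proof (induction ps)
  case (Cons p ps)
  then show ?case
    using mvars_add[of p "sum_list ps"] by auto
qed simp

lemma mvars_prod_list:
  fixes ps :: "('v, 'a::comm_semiring_1) mpoly list"
  shows "mvars (prod_list ps) \<subseteq> (\<Union>p\<in>set ps. mvars p)"
proof (induction ps)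
  case (Cons p ps)
  then show ?case
    using mvars_mult[of p "prod_list ps"] by auto
qed simp

lemma multilinear_0 [simp]: "multilinear 0"
  by (simp add: multilinear_def)

lemma multilinear_mconst [simp]: "multilinear (mconst c)"
  by (auto simp: multilinear_def mconst_def split: if_splits)

lemma multilinear_1 [simp]: "multilinear (1 :: ('v, 'a::comm_semiring_1) mpoly)"
  by (simp flip: mconst_1)

lemma multilinear_mvar [simp]: "multilinear (mvar v)"
  by (simp add: multilinear_def mvar_def lookup_single when_def)

lemma multilinear_add: "multilinear p \<Longrightarrow> multilinear q \<Longrightarrow> multilinear (p + q)"
  using keys_add[of p q] by (auto simp: multilinear_def)

text \<open>With disjoint variables, at each \<open>v\<close> at most one of the two factors has a
  nonzero exponent, so exponents never add up to 2.\<close>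

lemma multilinear_mult:
  assumes "multilinear p" "multilinear q" "mvars p \<inter> mvars q = {}"
  shows "multilinear (p * q)"
  unfolding multilinear_def
proof (intro ballI allI)
  fix u v
  assume "u \<in> Poly_Mapping.keys (p * q)"
  then obtain a b where ab: "a \<in> Poly_Mapping.keys p" "b \<in> Poly_Mapping.keys q" "u = a + b"
    by (rule keys_multE)
  have "v \<notin> Poly_Mapping.keys a \<or> v \<notin> Poly_Mapping.keys b"
    using assms(3) ab by (auto simp: mvars_def)
  then have "Poly_Mapping.lookup a v = 0 \<or> Poly_Mapping.lookup b v = 0"
    by (simp add: in_keys_iff)
  moreover have "Poly_Mapping.lookup a v \<le> 1" "Poly_Mapping.lookup b v \<le> 1"
    using assms(1,2) ab by (auto simp: multilinear_def)
  ultimately show "Poly_Mapping.lookup u v \<le> 1"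
    using ab(3) by (auto simp: lookup_add)
qed

lemma multilinear_sum_list: "(\<And>p. p \<in> set ps \<Longrightarrow> multilinear p) \<Longrightarrow> multilinear (sum_list ps)"
  by (induction ps) (simp_all add: multilinear_add)

text \<open>\<open>sorted_wrt\<close> states disjointness for pairs of positions rather than pairs
  of distinct entries, so a repeated entry is covered as well.\<close>

lemma multilinear_prod_list:
  fixes ps :: "('v, 'a::comm_semiring_1) mpoly list"
  assumes "\<And>p. p \<in> set ps \<Longrightarrow> multilinear p"
    and "sorted_wrt (\<lambda>p q. mvars p \<inter> mvars q = {}) ps"
  shows "multilinear (prod_list ps)"
  using assms
proof (induction ps)
  case (Cons p ps)
  then have "mvars p \<inter> mvars (prod_list ps) = {}"
    using mvars_prod_list[of ps] by fastforce
  then show ?case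
    using Cons by (simp add: multilinear_mult)
qed simp

section \<open>Multilinearity of formulas from syntactic disjointness\<close>

lemma formula_vars_simps [simp]:
  "formula_vars (Var v) = {v}"
  "formula_vars (Const c) = {}"
  "formula_vars (Add \<phi>s) = (\<Union>\<phi>\<in>set \<phi>s. formula_vars \<phi>)"
  "formula_vars (Mul \<phi>s) = (\<Union>\<phi>\<in>set \<phi>s. formula_vars \<phi>)"
  by (auto simp: formula_vars_def)

text \<open>Cancellation can make the inclusion strict. It lets disjointness be checked on the
  leaves of formulas instead of on the polynomials they compute.\<close>

lemma mvars_formula_poly:
  fixes \<phi> :: "('v, 'a::comm_semiring_1) formula"
  shows "mvars (formula_poly \<phi>) \<subseteq> formula_vars \<phi>"
proof (induction \<phi>)
  case (Add \<phi>s)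
  then show ?case
    using mvars_sum_list[of "map formula_poly \<phi>s"] by auto blast
next
  case (Mul \<phi>s)
  then show ?case
    using mvars_prod_list[of "map formula_poly \<phi>s"] by auto blast
qed simp_all

lemma multilinear_formula_Var [simp]: "multilinear_formula (Var v)"
  by (simp add: multilinear_formula_def)

lemma multilinear_formula_Const [simp]: "multilinear_formula (Const c)"
  by (simp add: multilinear_formula_def)

lemma self_in_gates: "\<phi> \<in> gates \<phi>"
  by (cases \<phi>) simp_all

lemma multilinear_formula_poly: "multilinear_formula \<phi> \<Longrightarrow> multilinear (formula_poly \<phi>)"
  by (simp add: multilinear_formula_def self_in_gates)

lemma multilinear_formula_Add:
  assumes "\<And>\<phi>. \<phi> \<in> set \<phi>s \<Longrightarrow> multilinear_formula \<phi>"
  shows "multilinear_formula (Add \<phi>s)"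
proof -
  have "multilinear (sum_list (map formula_poly \<phi>s))"
    using assms by (intro multilinear_sum_list) (auto intro: multilinear_formula_poly)
  then show ?thesis
    using assms by (auto simp: multilinear_formula_def)
qed

lemma multilinear_formula_Mul:
  fixes \<phi>s :: "('v, 'a::comm_semiring_1) formula list"
  assumes "\<And>\<phi>. \<phi> \<in> set \<phi>s \<Longrightarrow> multilinear_formula \<phi>"
    and "sorted_wrt (\<lambda>\<phi> \<psi>. formula_vars \<phi> \<inter> formula_vars \<psi> = {}) \<phi>s"
  shows "multilinear_formula (Mul \<phi>s)"
proof -
  have "mvars (formula_poly \<phi>) \<inter> mvars (formula_poly \<psi>) = {}"
    if "formula_vars \<phi> \<inter> formula_vars \<psi> = {}" for \<phi> \<psi> :: "('v, 'a) formula"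
    using that mvars_formula_poly[of \<phi>] mvars_formula_poly[of \<psi>] by auto
  then have "sorted_wrt (\<lambda>p q. mvars p \<inter> mvars q = {}) (map formula_poly \<phi>s)"
    unfolding sorted_wrt_map using assms(2) by (rule sorted_wrt_mono_rel)
  then have "multilinear (prod_list (map formula_poly \<phi>s))"
    using assms(1) by (intro multilinear_prod_list) (auto intro: multilinear_formula_poly)
  then show ?thesis
    using assms by (auto simp: multilinear_formula_def)
qed

section \<open>Sums of products\<close>

text \<open>The top sum gate is left out of the count, so that bounds simply add when two lists of
  product gates are concatenated; the gate costs 1 once at the end. Taking \<open>P\<close> to be
  \<open>is_leaf\<close> gives depth 2, and \<open>sum_of is_leaf\<close> gives depth 3.\<close>

definition sum_of_products_size ::
    "(('v, 'a::comm_semiring_1) formula \<Rightarrow> bool) \<Rightarrow> 'v set \<Rightarrow> nat \<Rightarrow> ('v, 'a) mpoly \<Rightarrow> bool" where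
  "sum_of_products_size P V k p \<longleftrightarrow>
     (\<exists>\<phi>s. (\<forall>\<phi>\<in>set \<phi>s. prod_of P \<phi> \<and> multilinear_formula \<phi> \<and> formula_vars \<phi> \<subseteq> V) \<and>
           sum_list (map formula_poly \<phi>s) = p \<and> sum_list (map formula_size \<phi>s) \<le> k)"

lemma sum_of_products_size_formula:
  assumes "sum_of_products_size P V k p"
  shows "\<exists>\<Phi>. sum_of (prod_of P) \<Phi> \<and> multilinear_formula \<Phi> \<and> formula_vars \<Phi> \<subseteq> V \<and>
             formula_poly \<Phi> = p \<and> formula_size \<Phi> \<le> k + 1"
proof -
  from assms obtain \<phi>s where
    "\<forall>\<phi>\<in>set \<phi>s. prod_of P \<phi> \<and> multilinear_formula \<phi> \<and> formula_vars \<phi> \<subseteq> V"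
    "sum_list (map formula_poly \<phi>s) = p" "sum_list (map formula_size \<phi>s) \<le> k"
    by (auto simp: sum_of_products_size_def)
  then show ?thesis
    by (intro exI[of _ "Add \<phi>s"]) (auto simp: sum_of_def intro: multilinear_formula_Add)
qed

lemma sum_of_products_size_mono:
  "sum_of_products_size P V k p \<Longrightarrow> k \<le> l \<Longrightarrow> sum_of_products_size P V l p"
  by (fastforce simp: sum_of_products_size_def)

lemma sum_of_products_size_0: "sum_of_products_size P V k 0"
  unfolding sum_of_products_size_def by (rule exI[of _ "[]"]) simp

lemma sum_of_products_size_add:
  assumes "sum_of_products_size P V k p" "sum_of_products_size P V l q"
  shows "sum_of_products_size P V (k + l) (p + q)"
proof -
  from assms obtain \<phi>s \<psi>s where
    "\<forall>\<phi>\<in>set \<phi>s. prod_of P \<phi> \<and> multilinear_formula \<phi> \<and> formula_vars \<phi> \<subseteq> V"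
    "sum_list (map formula_poly \<phi>s) = p" "sum_list (map formula_size \<phi>s) \<le> k"
    "\<forall>\<phi>\<in>set \<psi>s. prod_of P \<phi> \<and> multilinear_formula \<phi> \<and> formula_vars \<phi> \<subseteq> V"
    "sum_list (map formula_poly \<psi>s) = q" "sum_list (map formula_size \<psi>s) \<le> l"
    unfolding sum_of_products_size_def by blast
  then show ?thesis
    unfolding sum_of_products_size_def by (intro exI[of _ "\<phi>s @ \<psi>s"]) auto
qed

lemma sum_of_products_size_sum:
  assumes "finite A" "card A \<le> N" "\<And>i. i \<in> A \<Longrightarrow> sum_of_products_size P V k (p i)"
  shows "sum_of_products_size P V (N * k) (\<Sum>i\<in>A. p i)"
proof -
  have "sum_of_products_size P V (card A * k) (\<Sum>i\<in>A. p i)"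
    using assms(1,3)
    by (induction A) (simp_all add: sum_of_products_size_0 sum_of_products_size_add)
  then show ?thesis
    by (rule sum_of_products_size_mono) (simp add: assms(2))
qed

lemma sum_of_products_size_Mul:
  assumes "\<And>\<phi>. \<phi> \<in> set \<phi>s \<Longrightarrow> P \<phi> \<and> multilinear_formula \<phi> \<and> formula_vars \<phi> \<subseteq> V"
    and "sorted_wrt (\<lambda>\<phi> \<psi>. formula_vars \<phi> \<inter> formula_vars \<psi> = {}) \<phi>s"
    and "1 + sum_list (map formula_size \<phi>s) \<le> k"
  shows "sum_of_products_size P V k (prod_list (map formula_poly \<phi>s))"
  unfolding sum_of_products_size_def
  using assms by (intro exI[of _ "[Mul \<phi>s]"]) (auto simp: prod_of_def intro!: multilinear_formula_Mul)

text \<open>Besides one leaf per variable, the 2 pays for the product gate and the leaf holding the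
  coefficient.\<close>

lemma sum_of_products_size_monomial:
  assumes "finite S" "S \<subseteq> V" "card S + 2 \<le> k"
  shows "sum_of_products_size is_leaf V k (mconst c * (\<Prod>v\<in>S. mvar v))"
proof -
  obtain vs where vs: "S = set vs" "distinct vs"
    using assms(1) finite_distinct_list by blast
  let ?\<phi>s = "Const c # map Var vs"
  have "sum_of_products_size is_leaf V k (prod_list (map formula_poly ?\<phi>s))"
  proof (rule sum_of_products_size_Mul)
    show "sorted_wrt (\<lambda>\<phi> \<psi>. formula_vars \<phi> \<inter> formula_vars \<psi> = {}) ?\<phi>s"
      using vs(2) by (simp add: sorted_wrt_map) (induction vs; auto)
    show "1 + sum_list (map formula_size ?\<phi>s) \<le> k"
      using assms(3) vs distinct_card[OF vs(2)] by (simp add: o_def sum_list_triv)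
  qed (use assms(2) vs in \<open>auto simp: is_leaf_def\<close>)
  then show ?thesis
    using vs by (simp add: o_def prod.distinct_set_conv_list)
qed

text \<open>Each factor is a sum gate with at most two leaves, hence of size at most 3. The other 3
  nodes are the product gate, the constant and the unary sum gate around that constant.\<close>

lemma sum_of_products_size_prod_sums:
  fixes F :: "'i \<Rightarrow> 'v set" and c :: "'a::comm_semiring_1"
  assumes "finite I" "\<And>i. i \<in> I \<Longrightarrow> finite (F i) \<and> F i \<subseteq> V \<and> card (F i) \<le> 2"
    and "\<And>i j. i \<in> I \<Longrightarrow> j \<in> I \<Longrightarrow> i \<noteq> j \<Longrightarrow> F i \<inter> F j = {}"
    and "3 * card I + 3 \<le> k"
  shows "sum_of_products_size (sum_of is_leaf) V k (mconst c * (\<Prod>i\<in>I. \<Sum>v\<in>F i. mvar v))"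
proof -
  obtain "is" where "is": "I = set is" "distinct is"
    using assms(1) finite_distinct_list by blast
  have "\<forall>i\<in>I. \<exists>vs. F i = set vs \<and> distinct vs"
    using assms(2) finite_distinct_list by metis
  then obtain vs where vs: "\<And>i. i \<in> I \<Longrightarrow> F i = set (vs i) \<and> distinct (vs i)"
    by metis
  have F_V: "v \<in> V" if "i \<in> I" "v \<in> F i" for i v
    using assms(2) that by blast
  let ?\<phi> = "\<lambda>i. Add (map Var (vs i))"
  \<comment> \<open>In depth 3 every child of a product gate has to be a sum gate, so the
    coefficient is wrapped in a sum with one term.\<close>
  let ?\<phi>s = "Add [Const c] # map ?\<phi> is"
  have size: "formula_size (?\<phi> i :: ('v, 'a) formula) \<le> 3" if "i \<in> I" for i
    using that vs[OF that] assms(2)[OF that] by (simp add: o_def sum_list_triv distinct_card flip: distinct_card)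
  have "sum_of_products_size (sum_of is_leaf) V k (prod_list (map formula_poly ?\<phi>s))"
  proof (rule sum_of_products_size_Mul)
    \<comment> \<open>Since \<open>is\<close> is distinct, different positions hold different
      indices, whose sets \<open>F i\<close> are disjoint by assumption.\<close>
    have "sorted_wrt (\<lambda>i j. F i \<inter> F j = {}) is"
      unfolding sorted_wrt_iff_nth_less
      using "is" assms(3) by (metis distinct_conv_nth nat_neq_iff nth_mem order_less_trans)
    then have "sorted_wrt (\<lambda>i j. set (vs i) \<inter> set (vs j) = {}) is"
      by (rule sorted_wrt_mono_rel[rotated]) (simp add: vs "is"(1))
    then show "sorted_wrt (\<lambda>\<phi> \<psi>. formula_vars \<phi> \<inter> formula_vars \<psi> = {}) ?\<phi>s"
      by (simp add: sorted_wrt_map)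
    have "(\<Sum>i\<leftarrow>is. formula_size (?\<phi> i :: ('v, 'a) formula)) \<le> (\<Sum>i\<leftarrow>is. 3)"
      by (rule sum_list_mono) (use size "is"(1) in blast)
    also have "\<dots> = 3 * card I"
      using "is" by (simp add: sum_list_triv distinct_card flip: distinct_card)
    finally show "1 + sum_list (map formula_size ?\<phi>s) \<le> k"
      using assms(4) by (simp add: o_def)
  qed (use F_V vs "is" in \<open>auto simp: is_leaf_def sum_of_def intro!: multilinear_formula_Add\<close>)
  moreover have "(\<Prod>i\<leftarrow>is. formula_poly (?\<phi> i)) = (\<Prod>i\<in>I. \<Sum>v\<in>F i. mvar v :: ('v, 'a) mpoly)"
  proof -
    have "formula_poly (?\<phi> i) = (\<Sum>v\<in>F i. mvar v :: ('v, 'a) mpoly)" if "i \<in> I" for i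
      using vs[OF that] by (simp add: o_def sum.distinct_set_conv_list)
    then show ?thesis
      using "is" by (simp add: prod.distinct_set_conv_list cong: map_cong)
  qed
  ultimately show ?thesis
    by (simp add: o_def)
qed

section \<open>The certificate\<close>

text \<open>The variables whose sum is the factor of P(x, z) at index \<open>i\<close>;
  \<open>K\<close> will be the set of indices shared by the two monomials.\<close>

definition block :: "nat set \<Rightarrow> nat \<Rightarrow> ips_var set" where
  "block K i = (if i \<in> K then {X i, Z i} else {X i})"

text \<open>This is c * (P(x, 0) - P(x, z)). The sign is put into the constant so that each half is
  a coefficient times a product, as the formula constructions expect.\<close>

definition product_correction :: "'a::comm_ring_1 \<Rightarrow> nat set \<Rightarrow> nat set \<Rightarrow> (ips_var, 'a) mpoly" where
  "product_correction c A B = mconst c * (\<Prod>v\<in>X ` (A \<union> B). mvar v)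
     + mconst (- c) * (\<Prod>i\<in>A \<union> B. \<Sum>v\<in>block (A \<inter> B) i. mvar v)"

definition certificate ::
    "nat \<Rightarrow> (nat \<Rightarrow> (nat, 'a::comm_ring_1) mpoly) \<Rightarrow> (nat \<Rightarrow> (nat, 'a) mpoly) \<Rightarrow> (ips_var, 'a) mpoly" where
  "certificate m f g = (\<Sum>j=1..m. \<Sum>u\<in>Poly_Mapping.keys (g j).
     mconst (Poly_Mapping.lookup (g j) u) * (\<Prod>v\<in>insert (Y j) (X ` Poly_Mapping.keys u). mvar v)
     + (\<Sum>w\<in>Poly_Mapping.keys (f j).
          product_correction (Poly_Mapping.lookup (g j) u * Poly_Mapping.lookup (f j) w)
            (Poly_Mapping.keys u) (Poly_Mapping.keys w)))"

lemma prod_X_image: "(\<Prod>v\<in>X ` A. h v) = (\<Prod>i\<in>A. h (X i))"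
  by (subst prod.reindex) (auto simp: inj_on_def)

lemma prod_insert_Y_X_image:
  "finite A \<Longrightarrow> (\<Prod>v\<in>insert (Y j) (X ` A). h v) = h (Y j) * (\<Prod>i\<in>A. h (X i))"
  by (subst prod.insert) (auto simp: prod_X_image)

lemma zero_subst_product_correction: "mpoly_subst zero_subst (product_correction c A B) = 0"
proof -
  have "(\<Sum>v\<in>block K i. zero_subst v) = (mvar i :: (nat, 'a) mpoly)" for K i
    by (simp add: block_def)
  then show ?thesis
    by (simp add: product_correction_def mpoly_subst_diff mpoly_subst_mult mpoly_subst_prod mpoly_subst_sum
        prod_X_image mconst_uminus)
qed

lemma zero_subst_certificate: "mpoly_subst zero_subst (certificate m f g) = 0"
  by (simp add: certificate_def mpoly_subst_sum mpoly_subst_add mpoly_subst_mult mpoly_subst_prod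
      prod_insert_Y_X_image zero_subst_product_correction)

text \<open>A block on the intersection becomes x_i + (x_i^2 - x_i) = x_i^2 and any other block
  becomes x_i.\<close>

lemma axiom_subst_product_correction:
  assumes "finite A" "finite B"
  shows "mpoly_subst (axiom_subst f) (product_correction c A B)
       = mconst c * ((\<Prod>i\<in>A \<union> B. mvar i) - (\<Prod>i\<in>A. mvar i) * (\<Prod>i\<in>B. mvar i))"
proof -
  \<comment> \<open>Factoring out \<open>mvar i\<close> splits the product into one over the union
    and one over the intersection, which together equal the product over \<open>A\<close> times the
    product over \<open>B\<close>.\<close>
  have block: "(\<Sum>v\<in>block K i. axiom_subst f v) = mvar i * (if i \<in> K then mvar i else 1)" for K i
    by (simp add: block_def bool_axiom_def power2_eq_square)
  have "(\<Prod>i\<in>A \<union> B. if i \<in> A \<inter> B then mvar i else 1) = (\<Prod>i\<in>A \<inter> B. mvar i :: (nat, 'a) mpoly)"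
    using assms by (subst prod.inter_restrict[symmetric]) (auto intro: arg_cong2[where f = prod])
  then have "(\<Prod>i\<in>A \<union> B. \<Sum>v\<in>block (A \<inter> B) i. axiom_subst f v)
      = (\<Prod>i\<in>A. mvar i) * (\<Prod>i\<in>B. mvar i)"
    using assms by (simp add: block prod.distrib prod.union_inter)
  then show ?thesis
    by (simp add: product_correction_def mpoly_subst_diff mpoly_subst_mult mpoly_subst_prod mpoly_subst_sum
        prod_X_image mconst_uminus right_diff_distrib)
qed

text \<open>For a fixed monomial of \<open>g j\<close>, the substituted y-term cancels against the
  products x^u x^w in the corrections. What survives is x to the union of the supports, the
  multilinearized form of the product monomial.\<close>

lemma axiom_subst_certificate:
  fixes f :: "nat \<Rightarrow> (nat, 'a::comm_ring_1) mpoly"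
  assumes "\<And>j. j \<in> {1..m} \<Longrightarrow> multilinear (f j)"
  shows "mpoly_subst (axiom_subst f) (certificate m f g) = multilinearize (\<Sum>j=1..m. g j * f j)"
proof -
  let ?M = "\<lambda>u. \<Prod>i\<in>Poly_Mapping.keys u. mvar i :: (nat, 'a) mpoly"
  have "mconst a * (f j * ?M u) +
        (\<Sum>w\<in>Poly_Mapping.keys (f j). mconst (a * Poly_Mapping.lookup (f j) w) *
          ((\<Prod>i\<in>Poly_Mapping.keys u \<union> Poly_Mapping.keys w. mvar i) - ?M u * ?M w))
      = (\<Sum>w\<in>Poly_Mapping.keys (f j). mconst (a * Poly_Mapping.lookup (f j) w) * ?M (u + w))"
    if "j \<in> {1..m}" for j a u
  proof -
    \<comment> \<open>Multilinearity of \<open>f j\<close> enters here: the support products x^w are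
      its actual monomials, so the cancellation is exact.\<close>
    have f: "(\<Sum>w\<in>Poly_Mapping.keys (f j). mconst (Poly_Mapping.lookup (f j) w) * ?M w) = f j"
      using multilinearize_multilinear[OF assms[OF that]]
      by (simp add: multilinearize_def replace_monomials_def)
    have "(\<Sum>w\<in>Poly_Mapping.keys (f j). mconst (a * Poly_Mapping.lookup (f j) w) * (?M u * ?M w))
        = mconst a * ((\<Sum>w\<in>Poly_Mapping.keys (f j). mconst (Poly_Mapping.lookup (f j) w) * ?M w) * ?M u)"
      by (simp add: sum_distrib_left sum_distrib_right mconst_mult mult_ac)
    then have "mconst a * (f j * ?M u)
        = (\<Sum>w\<in>Poly_Mapping.keys (f j). mconst (a * Poly_Mapping.lookup (f j) w) * (?M u * ?M w))"
      by (simp only: f)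
    then show ?thesis
      by (simp add: keys_add_nat right_diff_distrib sum_subtractf)
  qed
  then show ?thesis
    by (simp add: certificate_def mpoly_subst_sum mpoly_subst_add mpoly_subst_mult mpoly_subst_prod
        prod_insert_Y_X_image axiom_subst_product_correction multilinearize_def replace_monomials_sum
        replace_monomials_mult)
qed

section \<open>The degree in the y variables\<close>

lemma y_degree_add: "y_degree (u + w) = y_degree u + y_degree w"
proof -
  let ?A = "Poly_Mapping.keys u \<union> Poly_Mapping.keys w"
  have *: "y_degree v = (\<Sum>x\<in>?A \<inter> range Y. Poly_Mapping.lookup v x)" if "Poly_Mapping.keys v \<subseteq> ?A" for v
    unfolding y_degree_def using that by (intro sum.mono_neutral_left) (auto simp: in_keys_iff)
  show ?thesis
    by (simp add: * keys_add_nat lookup_add sum.distrib)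
qed

definition y_degree_le :: "nat \<Rightarrow> (ips_var, 'a::zero) mpoly \<Rightarrow> bool" where
  "y_degree_le k p \<longleftrightarrow> (\<forall>u\<in>Poly_Mapping.keys p. y_degree u \<le> k)"

lemma y_degree_le_add: "y_degree_le k p \<Longrightarrow> y_degree_le k q \<Longrightarrow> y_degree_le k (p + q)"
  using keys_add[of p q] by (auto simp: y_degree_le_def)

lemma y_degree_le_sum: "(\<And>i. i \<in> I \<Longrightarrow> y_degree_le k (p i)) \<Longrightarrow> y_degree_le k (\<Sum>i\<in>I. p i)"
  using keys_sum[of p I] by (fastforce simp: y_degree_le_def)

lemma y_degree_le_mult: "y_degree_le k p \<Longrightarrow> y_degree_le l q \<Longrightarrow> y_degree_le (k + l) (p * q)"
  by (fastforce simp: y_degree_le_def y_degree_add elim!: keys_multE intro: add_mono)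

lemma y_degree_le_mconst: "y_degree_le k (mconst c)"
  by (auto simp: y_degree_le_def mconst_def y_degree_def split: if_splits)

lemma y_degree_le_mvar: "y_degree_le (if v \<in> range Y then 1 else 0) (mvar v)"
  by (auto simp: y_degree_le_def mvar_def y_degree_def)

lemma y_degree_le_prod:
  assumes "\<And>i. i \<in> I \<Longrightarrow> y_degree_le (k i) (p i :: (ips_var, 'a::comm_semiring_1) mpoly)"
  shows "y_degree_le (\<Sum>i\<in>I. k i) (\<Prod>i\<in>I. p i)"
  using assms
  by (induction I rule: infinite_finite_induct)
    (simp_all add: y_degree_le_mult y_degree_le_mconst flip: mconst_1)

text \<open>A term from \<open>g j\<close> contains y_j exactly once as a factor and no other y
  variable, while the corrections involve only x and z variables.\<close>

lemma y_degree_le_certificate: "y_degree_le 1 (certificate m f g)"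
proof -
  have 1: "y_degree_le 1 (mconst c * (\<Prod>v\<in>insert (Y j) (X ` A). mvar v))"
    if "finite A" for c :: 'a and j A
  proof -
    have "y_degree_le (0 + (\<Sum>v\<in>insert (Y j) (X ` A). if v \<in> range Y then 1 else 0))
        (mconst c * (\<Prod>v\<in>insert (Y j) (X ` A). mvar v))"
      by (intro y_degree_le_mult y_degree_le_mconst y_degree_le_prod y_degree_le_mvar)
    moreover have "(\<Sum>v\<in>X ` A. if v \<in> range Y then 1 else 0) = (0::nat)"
      by (rule sum.neutral) auto
    ultimately show ?thesis
      using that by (subst (asm) sum.insert) auto
  qed
  have 2: "y_degree_le 1 (product_correction c A B)" for c :: 'a and A B
  proof -
    have x: "y_degree_le 0 (mvar v :: (ips_var, 'a) mpoly)" if "v \<notin> range Y" for v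
      using y_degree_le_mvar[of v] that by simp
    have "y_degree_le (0 + (\<Sum>v\<in>X ` (A \<union> B). 0)) (mconst c * (\<Prod>v\<in>X ` (A \<union> B). mvar v))"
      by (intro y_degree_le_mult y_degree_le_mconst y_degree_le_prod x) auto
    moreover have "y_degree_le (0 + (\<Sum>i\<in>A \<union> B. 0))
        (mconst (- c) * (\<Prod>i\<in>A \<union> B. \<Sum>v\<in>block (A \<inter> B) i. mvar v))"
      by (intro y_degree_le_mult y_degree_le_mconst y_degree_le_prod y_degree_le_sum x)
        (auto simp: block_def split: if_splits)
    ultimately have "y_degree_le 0 (product_correction c A B)"
      by (simp add: product_correction_def y_degree_le_add)
    then show ?thesis
      by (simp add: y_degree_le_def)
  qed
  show ?thesis
    unfolding certificate_def by (intro y_degree_le_sum y_degree_le_add 1 2) simp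
qed

section \<open>Formulas for the certificate\<close>

lemma depth3_product_correction:
  assumes "A \<subseteq> {1..n}" "B \<subseteq> {1..n}"
  shows "sum_of_products_size (sum_of is_leaf) (ips_vars n m) (6 * n + 6) (product_correction c A B)"
proof -
  have AB: "finite (A \<union> B)" "card (A \<union> B) \<le> n" "A \<union> B \<subseteq> {1..n}"
    using assms card_mono[of "{1..n}" "A \<union> B"] finite_subset[of _ "{1..n}"] by auto
  \<comment> \<open>The plain monomial is read as a product of one-term sums, so the same
    construction covers both halves.\<close>
  have "sum_of_products_size (sum_of is_leaf) (ips_vars n m) (3 * n + 3)
      (mconst c * (\<Prod>i\<in>A \<union> B. \<Sum>v\<in>{X i}. mvar v))"
    by (rule sum_of_products_size_prod_sums) (use AB in \<open>auto simp: ips_vars_def\<close>)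
  moreover have "sum_of_products_size (sum_of is_leaf) (ips_vars n m) (3 * n + 3)
      (mconst (- c) * (\<Prod>i\<in>A \<union> B. \<Sum>v\<in>block (A \<inter> B) i. mvar v))"
    by (rule sum_of_products_size_prod_sums) (use AB in \<open>auto simp: block_def ips_vars_def\<close>)
  ultimately show ?thesis
    using sum_of_products_size_add by (fastforce simp: product_correction_def prod_X_image)
qed

text \<open>Choosing z_i or x_i in each two-term factor gives one monomial per subset of
  \<open>A \<inter> B\<close>, at most \<open>2 ^ d\<close> of them because the intersection lies in
  \<open>B\<close>. The extra 1 counts P(x, 0), and each monomial has at most \<open>n\<close>
  variables.\<close>

lemma depth2_product_correction:
  assumes "A \<subseteq> {1..n}" "B \<subseteq> {1..n}" "card B \<le> d"
  shows "sum_of_products_size is_leaf (ips_vars n m) ((2 ^ d + 1) * (n + 2)) (product_correction c A B)"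
proof -
  have AB: "finite A" "finite B" "A \<union> B \<subseteq> {1..n}"
    using assms finite_subset[of _ "{1..n}"] by auto
  have card_AB: "card (A \<union> B) \<le> n"
    using AB(3) card_mono[of "{1..n}" "A \<union> B"] by simp
  define K where "K = A \<inter> B"
  have K: "finite K" "K \<subseteq> A \<union> B" "card K \<le> d"
    using AB assms(3) card_mono[of B K] by (auto simp: K_def)
  \<comment> \<open>\<open>S\<close> is the set of indices at which z_i is chosen; all remaining
    indices contribute x_i.\<close>
  define monomial_vars where "monomial_vars S = Z ` S \<union> X ` (A \<union> B - S)" for S
  have expand: "(\<Prod>i\<in>A \<union> B. \<Sum>v\<in>block K i. mvar v) = (\<Sum>S\<in>Pow K. \<Prod>v\<in>monomial_vars S. mvar v :: (ips_var, 'a) mpoly)"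
  proof -
    have "(\<Prod>i\<in>A \<union> B. \<Sum>v\<in>block K i. mvar v)
        = (\<Prod>i\<in>A \<union> B - K. mvar (X i)) * (\<Prod>i\<in>K. mvar (Z i) + mvar (X i) :: (ips_var, 'a) mpoly)"
      using AB K by (subst prod.subset_diff[of K]) (auto simp: block_def add.commute)
    also have "\<dots> = (\<Sum>S\<in>Pow K. (\<Prod>i\<in>S. mvar (Z i)) * ((\<Prod>i\<in>A \<union> B - K. mvar (X i)) * (\<Prod>i\<in>K - S. mvar (X i))))"
      by (simp add: prod_add K sum_distrib_left mult_ac)
    also have "\<dots> = (\<Sum>S\<in>Pow K. \<Prod>v\<in>monomial_vars S. mvar v)"
    proof (rule sum.cong)
      fix S assume "S \<in> Pow K"
      then have S: "S \<subseteq> K" "finite S"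
        using K(1) finite_subset by auto
      have "(\<Prod>i\<in>A \<union> B - S. mvar (X i) :: (ips_var, 'a) mpoly)
          = (\<Prod>i\<in>(A \<union> B - S) - (K - S). mvar (X i)) * (\<Prod>i\<in>K - S. mvar (X i))"
        using AB K by (intro prod.subset_diff) auto
      also have "(A \<union> B - S) - (K - S) = A \<union> B - K"
        using S by blast
      finally have X: "(\<Prod>v\<in>X ` (A \<union> B - S). mvar v :: (ips_var, 'a) mpoly)
          = (\<Prod>i\<in>A \<union> B - K. mvar (X i)) * (\<Prod>i\<in>K - S. mvar (X i))"
        by (simp only: prod_X_image)
      have Z: "(\<Prod>v\<in>Z ` S. mvar v) = (\<Prod>i\<in>S. mvar (Z i) :: (ips_var, 'a) mpoly)"
        by (subst prod.reindex) (auto simp: inj_on_def)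
      show "(\<Prod>i\<in>S. mvar (Z i)) * ((\<Prod>i\<in>A \<union> B - K. mvar (X i)) * (\<Prod>i\<in>K - S. mvar (X i)))
          = (\<Prod>v\<in>monomial_vars S. mvar v :: (ips_var, 'a) mpoly)"
        unfolding monomial_vars_def X[symmetric] Z[symmetric]
        using S AB by (intro prod.union_disjoint[symmetric]) auto
    qed simp
    finally show ?thesis .
  qed
  have "sum_of_products_size is_leaf (ips_vars n m) (n + 2) (mconst a * (\<Prod>v\<in>monomial_vars S. mvar v))"
    if "S \<subseteq> A \<union> B" for S and a :: 'a
  proof (rule sum_of_products_size_monomial)
    have "finite S"
      using that AB finite_subset by blast
    then show "finite (monomial_vars S)"
      using AB by (simp add: monomial_vars_def)
    have "S \<subseteq> {1..n}"
      using that AB(3) by (rule subset_trans)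
    then show "monomial_vars S \<subseteq> ips_vars n m"
      using AB(3) by (auto simp: monomial_vars_def ips_vars_def)
    have "card (monomial_vars S) \<le> card S + card (A \<union> B - S)"
      unfolding monomial_vars_def using AB \<open>finite S\<close>
      by (intro order.trans[OF card_Un_le] add_mono card_image_le) auto
    also have "\<dots> = card (A \<union> B)"
      using that AB \<open>finite S\<close> by (simp add: card_Diff_subset card_mono)
    finally show "card (monomial_vars S) + 2 \<le> n + 2"
      using card_AB by simp
  qed
  note monomial = this
  have "sum_of_products_size is_leaf (ips_vars n m) (2 ^ d * (n + 2))
      (\<Sum>S\<in>Pow K. mconst (- c) * (\<Prod>v\<in>monomial_vars S. mvar v))"
    using K by (intro sum_of_products_size_sum monomial) (auto simp: card_Pow)
  moreover have "sum_of_products_size is_leaf (ips_vars n m) (n + 2) (mconst c * (\<Prod>v\<in>X ` (A \<union> B). mvar v))"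
    \<comment> \<open>Choosing no z at all yields the monomial P(x, 0).\<close>
    using monomial[of "{}"] by (simp add: monomial_vars_def)
  ultimately have "sum_of_products_size is_leaf (ips_vars n m) (n + 2 + 2 ^ d * (n + 2)) (product_correction c A B)"
    unfolding product_correction_def K_def[symmetric] expand sum_distrib_left by (intro sum_of_products_size_add)
  then show ?thesis
    by (simp add: algebra_simps)
qed

text \<open>Stated for any \<open>P\<close> so that it serves both depths: \<open>k\<close> is the
  cost of a y-term and \<open>l\<close> that of a correction, and there are at most \<open>t\<close>
  monomials in each \<open>g j\<close> and \<open>s\<close> in each \<open>f j\<close>.\<close>

lemma sum_of_products_size_certificate:
  assumes "\<And>j u c. j \<in> {1..m} \<Longrightarrow> u \<in> Poly_Mapping.keys (g j) \<Longrightarrow>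
      sum_of_products_size P V k (mconst c * (\<Prod>v\<in>insert (Y j) (X ` Poly_Mapping.keys u). mvar v))"
    and "\<And>j u w c. j \<in> {1..m} \<Longrightarrow> u \<in> Poly_Mapping.keys (g j) \<Longrightarrow> w \<in> Poly_Mapping.keys (f j) \<Longrightarrow>
      sum_of_products_size P V l (product_correction c (Poly_Mapping.keys u) (Poly_Mapping.keys w))"
    and "\<And>j. j \<in> {1..m} \<Longrightarrow> sparse t (g j) \<and> sparse s (f j)"
  shows "sum_of_products_size P V (m * (t * (k + s * l))) (certificate m f g)"
  unfolding certificate_def
  by (intro sum_of_products_size_sum sum_of_products_size_add assms(1,2))
    (use assms(3) in \<open>auto simp: sparse_def\<close>)

section \<open>From the certificate to refutations and explicit bounds\<close>

lemma keys_subset_xpolys: "p \<in> xpolys n \<Longrightarrow> u \<in> Poly_Mapping.keys p \<Longrightarrow> Poly_Mapping.keys u \<subseteq> {1..n}"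
  by (auto simp: xpolys_def mvars_def)

text \<open>Each variable in the support has exponent at least 1. This converts the degree bound on
  \<open>f j\<close> into the support bound used for depth 2.\<close>

lemma card_keys_le_total_degree:
  assumes "u \<in> Poly_Mapping.keys p"
  shows "card (Poly_Mapping.keys u) \<le> total_degree p"
proof -
  have "card (Poly_Mapping.keys u) = (\<Sum>v\<in>Poly_Mapping.keys u. 1)"
    by simp
  also have "\<dots> \<le> monom_degree u"
    unfolding monom_degree_def by (intro sum_mono) (simp add: in_keys_iff Suc_le_eq)
  also have "\<dots> \<le> total_degree p"
    unfolding total_degree_def using assms by (intro Max_ge) auto
  finally show ?thesis .
qed

lemma multilinear_formula_proof_of_certificate:
  fixes f :: "nat \<Rightarrow> (nat, 'a::comm_ring_1) mpoly"
  assumes "\<And>j. j \<in> {1..m} \<Longrightarrow> multilinear (f j)"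
    and "(\<Sum>j=1..m. g j * f j) + (\<Sum>i=1..n. h i * bool_axiom i) = 1"
    and "sum_of_products_size P (ips_vars n m) k (certificate m f g)"
  shows "\<exists>\<Phi>. multilinear_formula_ips_lin'_proof n m f \<Phi> \<and> sum_of (prod_of P) \<Phi> \<and> formula_size \<Phi> \<le> k + 1"
proof -
  obtain \<Phi> where \<Phi>: "sum_of (prod_of P) \<Phi>" "multilinear_formula \<Phi>" "formula_vars \<Phi> \<subseteq> ips_vars n m"
    "formula_poly \<Phi> = certificate m f g" "formula_size \<Phi> \<le> k + 1"
    using sum_of_products_size_formula[OF assms(3)] by blast
  \<comment> \<open>The multiples of the Boolean axioms multilinearize to 0, so the left side is the
    multilinearization of the constant 1.\<close>
  have "multilinearize (\<Sum>j=1..m. g j * f j)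
      = multilinearize ((\<Sum>j=1..m. g j * f j) + (\<Sum>i=1..n. h i * bool_axiom i))"
    by (simp add: multilinearize_def replace_monomials_add replace_monomials_sum
        multilinearize_mult_bool_axiom[unfolded multilinearize_def])
  then have "mpoly_subst (axiom_subst f) (certificate m f g) = 1"
    by (simp only: axiom_subst_certificate assms(1,2) multilinearize_1)
  then have "ips_lin'_refutation n m f (formula_poly \<Phi>)"
    using \<Phi>(3,4) mvars_formula_poly[of \<Phi>] y_degree_le_certificate[of m f g]
    by (auto simp: ips_lin'_refutation_def zero_subst_certificate y_degree_le_def)
  then show ?thesis
    using \<Phi> by (auto simp: multilinear_formula_ips_lin'_proof_def)
qed

text \<open>\<open>N\<close> stands for the sum of all parameters plus 1, which absorbs the additive
  constants: 3 * n + 6 and 6 * n + 6 are both at most 6 * N.\<close>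

lemma size_bound_depth3:
  fixes s t n m N :: nat
  assumes "s \<le> N" "t \<le> N" "m \<le> N" "1 + n \<le> N"
  shows "m * (t * ((3 * n + 6) + s * (6 * n + 6))) + 1 \<le> 13 * N ^ 13"
proof -
  have "1 \<le> N"
    using assms by simp
  have "s * (6 * n + 6) \<le> N * (6 * N)"
    using assms by (intro mult_mono) auto
  moreover have "3 * n + 6 \<le> N * (6 * N)"
    using assms mult_le_mono1[OF \<open>1 \<le> N\<close>, of "6 * N"] by linarith
  ultimately have "m * (t * ((3 * n + 6) + s * (6 * n + 6))) \<le> N * (N * (N * (6 * N) + N * (6 * N)))"
    using assms by (intro mult_mono add_mono) auto
  also have "\<dots> = 12 * N ^ 4"
    by (simp add: power4_eq_xxxx)
  also have "\<dots> + 1 \<le> 13 * N ^ 4"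
    using \<open>1 \<le> N\<close> one_le_power[of N 4] by linarith
  also have "\<dots> \<le> 13 * N ^ 13"
    using \<open>1 \<le> N\<close> by (simp add: power_increasing)
  finally show ?thesis
    by simp
qed

text \<open>Here \<open>p\<close> stands for \<open>2 ^ d\<close>, kept abstract so that the
  estimate is purely polynomial.\<close>

lemma size_bound_depth2:
  fixes s t n m p N :: nat
  assumes "s \<le> N" "t \<le> N" "m \<le> N" "1 + n + p \<le> N" "1 \<le> p"
  shows "m * (t * ((n + 3) + s * ((p + 1) * (n + 2)))) + 1 \<le> 13 * N ^ 13"
proof -
  have "1 \<le> N"
    using assms by simp
  then have N3: "N \<le> N * (N * N)"
    by (cases N) auto
  have "s * ((p + 1) * (n + 2)) \<le> N * (N * (2 * N))"
    using assms by (intro mult_mono) auto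
  moreover have "n + 3 \<le> 3 * (N * (N * N))"
    using assms N3 by linarith
  ultimately have "m * (t * ((n + 3) + s * ((p + 1) * (n + 2)))) \<le> N * (N * (3 * (N * (N * N)) + N * (N * (2 * N))))"
    using assms by (intro mult_mono add_mono) auto
  also have "\<dots> = 5 * N ^ 5"
    by (simp add: eval_nat_numeral algebra_simps)
  also have "\<dots> + 1 \<le> 13 * N ^ 5"
    using \<open>1 \<le> N\<close> one_le_power[of N 5] by linarith
  also have "\<dots> \<le> 13 * N ^ 13"
    using \<open>1 \<le> N\<close> by (simp add: power_increasing)
  finally show ?thesis
    by simp
qed

theorem corollary4p16:
  shows "\<exists>c::nat. \<forall>(n::nat) (m::nat) (d::nat) (s::nat) (t::nat)
      (f :: nat \<Rightarrow> (nat, 'a::field) mpoly).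
    (\<forall>j\<in>{1..m}. f j \<in> xpolys n \<and> multilinear (f j) \<and> total_degree (f j) \<le> d \<and> sparse s (f j)) \<longrightarrow>
    \<not> (\<exists>a. (\<forall>i\<in>{1..n}. a i \<in> {0, 1}) \<and> (\<forall>j\<in>{1..m}. mpoly_eval a (f j) = 0)) \<longrightarrow>
    (\<exists>g h. sparse_lin_ips_refutation t n m f g h) \<longrightarrow>
      (\<exists>\<Phi>. multilinear_formula_ips_lin'_proof n m f \<Phi> \<and> depth2 \<Phi> \<and>
           formula_size \<Phi> \<le> c * (1 + s + t + n + m + 2 ^ d) ^ c) \<and>
      (\<exists>\<Phi>. multilinear_formula_ips_lin'_proof n m f \<Phi> \<and> depth3 \<Phi> \<and>
           formula_size \<Phi> \<le> c * (1 + s + t + n + m + d) ^ c)"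
\<comment> \<open>One number must serve as coefficient and as exponent. The coefficient 13 comes
  from 12 * N ^ 4 + 1 in depth 3; as an exponent it dominates the degrees 4 and 5 that
  occur.\<close>
proof (intro exI[of _ 13] allI impI, elim exE)
  fix n m d s t :: nat and f g h :: "nat \<Rightarrow> (nat, 'a) mpoly"
  assume f: "\<forall>j\<in>{1..m}. f j \<in> xpolys n \<and> multilinear (f j) \<and> total_degree (f j) \<le> d \<and> sparse s (f j)"
    and ref: "sparse_lin_ips_refutation t n m f g h"
  have keys_g: "Poly_Mapping.keys u \<subseteq> {1..n}"
    if "j \<in> {1..m}" "u \<in> Poly_Mapping.keys (g j)" for j u
    using ref that by (intro keys_subset_xpolys) (auto simp: sparse_lin_ips_refutation_def)
  have keys_f: "Poly_Mapping.keys w \<subseteq> {1..n}" "card (Poly_Mapping.keys w) \<le> d"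
    if "j \<in> {1..m}" "w \<in> Poly_Mapping.keys (f j)" for j w
    using f that keys_subset_xpolys[of "f j" n w] card_keys_le_total_degree[of w "f j"] by fastforce+
  have sparse: "sparse t (g j) \<and> sparse s (f j)" if "j \<in> {1..m}" for j
    using f ref that by (simp add: sparse_lin_ips_refutation_def)
  have YX: "insert (Y j) (X ` Poly_Mapping.keys u) \<subseteq> ips_vars n m"
    "card (insert (Y j) (X ` Poly_Mapping.keys u)) \<le> n + 1"
    if "j \<in> {1..m}" "u \<in> Poly_Mapping.keys (g j)" for j u
  proof -
    note u = keys_g[OF that]
    show "insert (Y j) (X ` Poly_Mapping.keys u) \<subseteq> ips_vars n m"
      using u that by (auto simp: ips_vars_def)
    have "card (X ` Poly_Mapping.keys u) \<le> n"
      using card_image_le[of "Poly_Mapping.keys u" X] card_mono[OF _ u] by simp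
    then show "card (insert (Y j) (X ` Poly_Mapping.keys u)) \<le> n + 1"
      using card_insert_le_m1[of "n + 1"] by simp
  qed
  have sum: "(\<Sum>j=1..m. g j * f j) + (\<Sum>i=1..n. h i * bool_axiom i) = 1"
    using ref by (simp add: sparse_lin_ips_refutation_def)
  have f_multilinear: "multilinear (f j)" if "j \<in> {1..m}" for j
    using f that by blast
  note proof_of_certificate = multilinear_formula_proof_of_certificate[OF f_multilinear sum]
  \<comment> \<open>A y-term has at most n + 1 variables, namely y_j and up to n of the x_i, so with
    the overhead of 2 it costs n + 3.\<close>
  have "sum_of_products_size is_leaf (ips_vars n m)
      (m * (t * ((n + 3) + s * ((2 ^ d + 1) * (n + 2))))) (certificate m f g)"
  proof (rule sum_of_products_size_certificate)
    fix j u and c :: 'a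
    assume "j \<in> {1..m}" "u \<in> Poly_Mapping.keys (g j)"
    then show "sum_of_products_size is_leaf (ips_vars n m) (n + 3)
        (mconst c * (\<Prod>v\<in>insert (Y j) (X ` Poly_Mapping.keys u). mvar v))"
      using YX by (intro sum_of_products_size_monomial) fastforce+
  next
    fix j u w and c :: 'a
    assume "j \<in> {1..m}" "u \<in> Poly_Mapping.keys (g j)" "w \<in> Poly_Mapping.keys (f j)"
    then show "sum_of_products_size is_leaf (ips_vars n m) ((2 ^ d + 1) * (n + 2))
        (product_correction c (Poly_Mapping.keys u) (Poly_Mapping.keys w))"
      by (intro depth2_product_correction keys_g keys_f)
  qed (rule sparse)
  then obtain \<Phi> where \<Phi>: "multilinear_formula_ips_lin'_proof n m f \<Phi>" "depth2 \<Phi>"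
    "formula_size \<Phi> \<le> m * (t * ((n + 3) + s * ((2 ^ d + 1) * (n + 2)))) + 1"
    using proof_of_certificate unfolding depth2_def by blast
  have "formula_size \<Phi> \<le> 13 * (1 + s + t + n + m + 2 ^ d) ^ 13"
    using \<Phi>(3) by (rule order.trans) (rule size_bound_depth2, auto)
  moreover have "sum_of_products_size (sum_of is_leaf) (ips_vars n m)
      (m * (t * ((3 * n + 6) + s * (6 * n + 6)))) (certificate m f g)"
  proof (rule sum_of_products_size_certificate)
    fix j u and c :: 'a
    assume ju: "j \<in> {1..m}" "u \<in> Poly_Mapping.keys (g j)"
    \<comment> \<open>Each variable is again a one-term sum; at most n + 1 factors give 3 * (n + 1)
      + 3 = 3 * n + 6.\<close>
    have "sum_of_products_size (sum_of is_leaf) (ips_vars n m) (3 * n + 6)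
        (mconst c * (\<Prod>v\<in>insert (Y j) (X ` Poly_Mapping.keys u). \<Sum>v'\<in>{v}. mvar v'))"
      using YX[OF ju] by (intro sum_of_products_size_prod_sums) auto
    then show "sum_of_products_size (sum_of is_leaf) (ips_vars n m) (3 * n + 6)
        (mconst c * (\<Prod>v\<in>insert (Y j) (X ` Poly_Mapping.keys u). mvar v))"
      by simp
  next
    fix j u w and c :: 'a
    assume "j \<in> {1..m}" "u \<in> Poly_Mapping.keys (g j)" "w \<in> Poly_Mapping.keys (f j)"
    then show "sum_of_products_size (sum_of is_leaf) (ips_vars n m) (6 * n + 6)
        (product_correction c (Poly_Mapping.keys u) (Poly_Mapping.keys w))"
      by (intro depth3_product_correction keys_g keys_f(1))
  qed (rule sparse)
  then obtain \<Psi> where \<Psi>: "multilinear_formula_ips_lin'_proof n m f \<Psi>" "depth3 \<Psi>"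
    "formula_size \<Psi> \<le> m * (t * ((3 * n + 6) + s * (6 * n + 6))) + 1"
    using proof_of_certificate unfolding depth3_def by blast
  have "formula_size \<Psi> \<le> 13 * (1 + s + t + n + m + d) ^ 13"
    using \<Psi>(3) by (rule order.trans) (rule size_bound_depth3, auto)
  ultimately show "(\<exists>\<Phi>. multilinear_formula_ips_lin'_proof n m f \<Phi> \<and> depth2 \<Phi> \<and>
           formula_size \<Phi> \<le> 13 * (1 + s + t + n + m + 2 ^ d) ^ 13) \<and>
      (\<exists>\<Phi>. multilinear_formula_ips_lin'_proof n m f \<Phi> \<and> depth3 \<Phi> \<and>
           formula_size \<Phi> \<le> 13 * (1 + s + t + n + m + d) ^ 13)"
    using \<Phi> \<Psi> by blast
qed

end
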